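(* Let $A$ be a lattice with zero such that $A\otimes L$ is a lattice for every lattice $L$ with zero (i.e., $A$ is weakly amenable). Then $A$ is amenable, that is, $A\otimes L$ is a capped tensor product for every lattice $L$ with zero.
   Context: Let $A$, $B$ be join-semilattices with zero. The lateral join on $A\times B$ is the partial operation defined on $\langle a_0,b_0\rangle,\langle a_1,b_1\rangle$ when $a_0=a_1$ or $b_0=b_1$, with value $\langle a_0\vee a_1,b_0\vee b_1\rangle$. Put $\bot_{A,B}=(A\times\{0_B\})\cup(\{0_A\}\times B)$. A bi-ideal of $A\times B$ is a down-set (for the componentwise order) of $A\times B$ containing $\bot_{A,B}$ and closed under lateral joins. The extended tensor product $A\bar{\otimes}B$ is the (algebraic) lattice of all bi-ideals of $A\times B$ under inclusion, and the tensor product $A\otimes B$ is the join-semilattice of all compact elements of $A\bar{\otimes}B$. A capping of a bi-ideal $I$ is a subset $\Gamma\subseteq A\times B$ such that $I$ is the down-set generated by $\Gamma\cup\bot_{A,B}$; $I$ is capped if it has a finite capping. $A\otimes B$ is a capped tensor product if all its elements are capped bi-ideals. A lattice $A$ with zero is amenable if $A\otimes L$ is a capped tensor product for every lattice $L$ with zero. *)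

theory Defs
  imports Main
begin

text \<open>Posets are given by a carrier set S and an order relation le on it.
  All notions below are relative to such carriers, so that one can quantify
  over lattices inside a formula.\<close>

definition partial_order_on' :: "'a set \<Rightarrow> ('a \<Rightarrow> 'a \<Rightarrow> bool) \<Rightarrow> bool" where
  "partial_order_on' S le \<longleftrightarrow>
     (\<forall>x\<in>S. le x x) \<and>
     (\<forall>x\<in>S. \<forall>y\<in>S. le x y \<and> le y x \<longrightarrow> x = y) \<and>
     (\<forall>x\<in>S. \<forall>y\<in>S. \<forall>z\<in>S. le x y \<and> le y z \<longrightarrow> le x z)"

definition is_lub_on :: "'a set \<Rightarrow> ('a \<Rightarrow> 'a \<Rightarrow> bool) \<Rightarrow> 'a \<Rightarrow> 'a \<Rightarrow> 'a \<Rightarrow> bool" where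
  "is_lub_on S le x y z \<longleftrightarrow> z \<in> S \<and> le x z \<and> le y z \<and>
     (\<forall>w\<in>S. le x w \<and> le y w \<longrightarrow> le z w)"

definition is_glb_on :: "'a set \<Rightarrow> ('a \<Rightarrow> 'a \<Rightarrow> bool) \<Rightarrow> 'a \<Rightarrow> 'a \<Rightarrow> 'a \<Rightarrow> bool" where
  "is_glb_on S le x y z \<longleftrightarrow> z \<in> S \<and> le z x \<and> le z y \<and>
     (\<forall>w\<in>S. le w x \<and> le w y \<longrightarrow> le w z)"

definition is_least_on :: "'a set \<Rightarrow> ('a \<Rightarrow> 'a \<Rightarrow> bool) \<Rightarrow> 'a \<Rightarrow> bool" where
  "is_least_on S le z \<longleftrightarrow> z \<in> S \<and> (\<forall>x\<in>S. le z x)"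

definition join_on :: "'a set \<Rightarrow> ('a \<Rightarrow> 'a \<Rightarrow> bool) \<Rightarrow> 'a \<Rightarrow> 'a \<Rightarrow> 'a" where
  "join_on S le x y = (THE z. is_lub_on S le x y z)"

definition zero_on :: "'a set \<Rightarrow> ('a \<Rightarrow> 'a \<Rightarrow> bool) \<Rightarrow> 'a" where
  "zero_on S le = (THE z. is_least_on S le z)"

definition lattice_zero_on :: "'a set \<Rightarrow> ('a \<Rightarrow> 'a \<Rightarrow> bool) \<Rightarrow> bool" where
  "lattice_zero_on S le \<longleftrightarrow> partial_order_on' S le \<and> (\<exists>z. is_least_on S le z) \<and>
     (\<forall>x\<in>S. \<forall>y\<in>S. (\<exists>z. is_lub_on S le x y z) \<and> (\<exists>z. is_glb_on S le x y z))"

definition bot_AB :: "'a set \<Rightarrow> ('a \<Rightarrow> 'a \<Rightarrow> bool) \<Rightarrow> 'b set \<Rightarrow> ('b \<Rightarrow> 'b \<Rightarrow> bool)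
    \<Rightarrow> ('a \<times> 'b) set" where
  "bot_AB A leA B leB = (A \<times> {zero_on B leB}) \<union> ({zero_on A leA} \<times> B)"

definition bi_ideal :: "'a set \<Rightarrow> ('a \<Rightarrow> 'a \<Rightarrow> bool) \<Rightarrow> 'b set \<Rightarrow> ('b \<Rightarrow> 'b \<Rightarrow> bool)
    \<Rightarrow> ('a \<times> 'b) set \<Rightarrow> bool" where
  "bi_ideal A leA B leB I \<longleftrightarrow>
     I \<subseteq> A \<times> B \<and>
     (\<forall>a b a' b'. (a, b) \<in> I \<and> a' \<in> A \<and> b' \<in> B \<and> leA a' a \<and> leB b' b \<longrightarrow> (a', b') \<in> I) \<and>
     bot_AB A leA B leB \<subseteq> I \<and>
     (\<forall>a0 b0 a1 b1. (a0, b0) \<in> I \<and> (a1, b1) \<in> I \<and> (a0 = a1 \<or> b0 = b1) \<longrightarrow>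
        (join_on A leA a0 a1, join_on B leB b0 b1) \<in> I)"

text \<open>The bi-ideal generated by a subset X of A x B (least bi-ideal containing X);
  this is the join operation of the complete lattice of bi-ideals.\<close>
definition bi_ideal_gen :: "'a set \<Rightarrow> ('a \<Rightarrow> 'a \<Rightarrow> bool) \<Rightarrow> 'b set \<Rightarrow> ('b \<Rightarrow> 'b \<Rightarrow> bool)
    \<Rightarrow> ('a \<times> 'b) set \<Rightarrow> ('a \<times> 'b) set" where
  "bi_ideal_gen A leA B leB X = \<Inter>{I. bi_ideal A leA B leB I \<and> X \<subseteq> I}"

text \<open>Compact elements of the extended tensor product (the lattice of all bi-ideals),
  i.e. the elements of the tensor product A (x) B.\<close>
definition compact_bi_ideal :: "'a set \<Rightarrow> ('a \<Rightarrow> 'a \<Rightarrow> bool) \<Rightarrow> 'b set \<Rightarrow> ('b \<Rightarrow> 'b \<Rightarrow> bool)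
    \<Rightarrow> ('a \<times> 'b) set \<Rightarrow> bool" where
  "compact_bi_ideal A leA B leB I \<longleftrightarrow> bi_ideal A leA B leB I \<and>
     (\<forall>F. (\<forall>J\<in>F. bi_ideal A leA B leB J) \<longrightarrow> I \<subseteq> bi_ideal_gen A leA B leB (\<Union>F) \<longrightarrow>
        (\<exists>G\<subseteq>F. finite G \<and> I \<subseteq> bi_ideal_gen A leA B leB (\<Union>G)))"

definition tensor_is_lattice :: "'a set \<Rightarrow> ('a \<Rightarrow> 'a \<Rightarrow> bool) \<Rightarrow> 'b set \<Rightarrow> ('b \<Rightarrow> 'b \<Rightarrow> bool) \<Rightarrow> bool" where
  "tensor_is_lattice A leA B leB \<longleftrightarrow>
     (\<forall>I J. compact_bi_ideal A leA B leB I \<and> compact_bi_ideal A leA B leB J \<longrightarrow>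
        (\<exists>K. compact_bi_ideal A leA B leB K \<and> K \<subseteq> I \<and> K \<subseteq> J \<and>
           (\<forall>K'. compact_bi_ideal A leA B leB K' \<and> K' \<subseteq> I \<and> K' \<subseteq> J \<longrightarrow> K' \<subseteq> K)) \<and>
        (\<exists>K. compact_bi_ideal A leA B leB K \<and> I \<subseteq> K \<and> J \<subseteq> K \<and>
           (\<forall>K'. compact_bi_ideal A leA B leB K' \<and> I \<subseteq> K' \<and> J \<subseteq> K' \<longrightarrow> K \<subseteq> K')))"

definition capped :: "'a set \<Rightarrow> ('a \<Rightarrow> 'a \<Rightarrow> bool) \<Rightarrow> 'b set \<Rightarrow> ('b \<Rightarrow> 'b \<Rightarrow> bool)
    \<Rightarrow> ('a \<times> 'b) set \<Rightarrow> bool" where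
  "capped A leA B leB I \<longleftrightarrow>
     (\<exists>\<Gamma>. finite \<Gamma> \<and> \<Gamma> \<subseteq> A \<times> B \<and>
        I = {(a, b). a \<in> A \<and> b \<in> B \<and>
               (\<exists>(c, d) \<in> \<Gamma> \<union> bot_AB A leA B leB. leA a c \<and> leB b d)})"

definition capped_tensor :: "'a set \<Rightarrow> ('a \<Rightarrow> 'a \<Rightarrow> bool) \<Rightarrow> 'b set \<Rightarrow> ('b \<Rightarrow> 'b \<Rightarrow> bool) \<Rightarrow> bool" where
  "capped_tensor A leA B leB \<longleftrightarrow>
     (\<forall>I. compact_bi_ideal A leA B leB I \<longrightarrow> capped A leA B leB I)"

end

theory Submission
  imports Defs
begin

text \<open>Write \<open>down y\<close> for the principal ideal of \<open>y\<close>.  Extend \<open>L\<close> to the lattice \<open>L'\<close> of pairs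
  \<open>(y, X)\<close> with \<open>down y \<subseteq> X \<subseteq> L\<close>, ordered componentwise.  Then \<open>y \<mapsto> (y, down y)\<close> is a lattice
  embedding, while the ideal below \<open>d = (0, L)\<close> consists of the pairs \<open>(0, X)\<close> and is distributive.
  Let \<open>I\<close> be a compact bi-ideal of \<open>A \<times> L\<close>, \<open>I'\<close> its image in \<open>A \<otimes> L'\<close>, and \<open>c\<close> a bound for the
  first coordinates of its generators.  As \<open>A \<otimes> L'\<close> is a lattice, the intersection of \<open>I'\<close> with the
  bi-ideal of \<open>(c, d)\<close> is generated by finitely many \<open>(x\<^sub>j, (0, X\<^sub>j))\<close>, with
  \<open>X\<^sub>j \<subseteq> down y\<^sub>j\<close> and \<open>(x\<^sub>j, y\<^sub>j) \<in> I\<close>.  If \<open>(x, y) \<in> I\<close>, then \<open>(x, (0, down y))\<close> lies in this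
  intersection, and distributivity forces \<open>x\<close> below the join of the \<open>x\<^sub>j\<close> with \<open>y \<in> X\<^sub>j\<close>; so the
  finitely many pairs (join of \<open>x\<^sub>j\<close>, meet of \<open>y\<^sub>j\<close>) over sets of indices \<open>j\<close> cap \<open>I\<close>.\<close>

section \<open>Lattices with zero on a carrier set\<close>

locale zero_lattice =
  fixes S :: "'a set" and le :: "'a \<Rightarrow> 'a \<Rightarrow> bool"
  assumes lattice_zero: "lattice_zero_on S le"
begin

abbreviation join where "join \<equiv> join_on S le"
abbreviation zero where "zero \<equiv> zero_on S le"

lemma refl: "x \<in> S \<Longrightarrow> le x x"
  and antisym: "x \<in> S \<Longrightarrow> y \<in> S \<Longrightarrow> le x y \<Longrightarrow> le y x \<Longrightarrow> x = y"
  and trans: "x \<in> S \<Longrightarrow> y \<in> S \<Longrightarrow> z \<in> S \<Longrightarrow> le x y \<Longrightarrow> le y z \<Longrightarrow> le x z"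
  using lattice_zero unfolding lattice_zero_on_def partial_order_on'_def by blast+

lemma join_eqI: "x \<in> S \<Longrightarrow> y \<in> S \<Longrightarrow> is_lub_on S le x y z \<Longrightarrow> join x y = z"
  unfolding join_on_def by (rule the_equality) (auto simp: is_lub_on_def intro: antisym)

lemma is_lub_join: "x \<in> S \<Longrightarrow> y \<in> S \<Longrightarrow> is_lub_on S le x y (join x y)"
  using lattice_zero join_eqI unfolding lattice_zero_on_def by metis

lemma join_closed [simp]: "x \<in> S \<Longrightarrow> y \<in> S \<Longrightarrow> join x y \<in> S"
  and join_ub1: "x \<in> S \<Longrightarrow> y \<in> S \<Longrightarrow> le x (join x y)"
  and join_ub2: "x \<in> S \<Longrightarrow> y \<in> S \<Longrightarrow> le y (join x y)"
  and join_least: "x \<in> S \<Longrightarrow> y \<in> S \<Longrightarrow> z \<in> S \<Longrightarrow> le x z \<Longrightarrow> le y z \<Longrightarrow> le (join x y) z"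
  using is_lub_join unfolding is_lub_on_def by blast+

lemma zero_eqI: "is_least_on S le z \<Longrightarrow> zero = z"
  unfolding zero_on_def by (rule the_equality) (auto simp: is_least_on_def intro: antisym)

lemma is_least_zero: "is_least_on S le zero"
  using lattice_zero zero_eqI unfolding lattice_zero_on_def by metis

lemma zero_closed [simp]: "zero \<in> S"
  and zero_le: "x \<in> S \<Longrightarrow> le zero x"
  using is_least_zero unfolding is_least_on_def by blast+

lemma le_zero: "x \<in> S \<Longrightarrow> le x zero \<Longrightarrow> x = zero"
  by (simp add: antisym zero_le)

lemma join_idem [simp]: "x \<in> S \<Longrightarrow> join x x = x"
  by (rule join_eqI) (auto simp: is_lub_on_def refl)

lemma join_zero [simp]: "x \<in> S \<Longrightarrow> join zero x = x" "x \<in> S \<Longrightarrow> join x zero = x"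
  by (rule join_eqI; auto simp: is_lub_on_def refl zero_le)+

lemma glb_exists:
  assumes "x \<in> S" "y \<in> S"
  obtains z where "z \<in> S" "le z x" "le z y" "\<And>w. w \<in> S \<Longrightarrow> le w x \<Longrightarrow> le w y \<Longrightarrow> le w z"
  using assms lattice_zero unfolding lattice_zero_on_def is_glb_on_def by metis

lemma finite_upper_bound:
  assumes "finite X" "X \<subseteq> S"
  shows "\<exists>u\<in>S. \<forall>x\<in>X. le x u"
  using assms
proof (induction X)
  case empty
  then show ?case using zero_closed by blast
next
  case (insert x X)
  then obtain u where "u \<in> S" "\<forall>y\<in>X. le y u" by blast
  with insert.prems show ?case
    by (intro bexI[of _ "join x u"]) (auto intro: join_ub1 join_ub2 trans[of _ u])
qed

end

section \<open>Bi-ideals: generation, compactness and finite bounds\<close>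

locale lattice_pair = A: zero_lattice A leA + B: zero_lattice B leB
  for A :: "'a set" and leA and B :: "'b set" and leB
begin

abbreviation bi where "bi \<equiv> bi_ideal A leA B leB"
abbreviation gen where "gen \<equiv> bi_ideal_gen A leA B leB"
abbreviation cpt where "cpt \<equiv> compact_bi_ideal A leA B leB"

text \<open>As joins are idempotent, a lateral join leaves the shared coordinate alone; closure
  therefore splits into one rule per coordinate.\<close>

lemma biI:
  assumes "I \<subseteq> A \<times> B"
    and "\<And>a b a' b'. (a, b) \<in> I \<Longrightarrow> a \<in> A \<Longrightarrow> b \<in> B \<Longrightarrow> a' \<in> A \<Longrightarrow> b' \<in> B
      \<Longrightarrow> leA a' a \<Longrightarrow> leB b' b \<Longrightarrow> (a', b') \<in> I"
    and "\<And>a. a \<in> A \<Longrightarrow> (a, B.zero) \<in> I" and "\<And>b. b \<in> B \<Longrightarrow> (A.zero, b) \<in> I"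
    and "\<And>a a' b. (a, b) \<in> I \<Longrightarrow> (a', b) \<in> I \<Longrightarrow> a \<in> A \<Longrightarrow> a' \<in> A \<Longrightarrow> b \<in> B
      \<Longrightarrow> (A.join a a', b) \<in> I"
    and "\<And>a b b'. (a, b) \<in> I \<Longrightarrow> (a, b') \<in> I \<Longrightarrow> a \<in> A \<Longrightarrow> b \<in> B \<Longrightarrow> b' \<in> B
      \<Longrightarrow> (a, B.join b b') \<in> I"
  shows "bi I"
proof -
  have "(A.join a0 a1, B.join b0 b1) \<in> I"
    if "(a0, b0) \<in> I" "(a1, b1) \<in> I" "a0 = a1 \<or> b0 = b1" for a0 b0 a1 b1
  proof -
    have "a0 \<in> A" "a1 \<in> A" "b0 \<in> B" "b1 \<in> B" using that assms(1) by auto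
    then show ?thesis using that assms(5)[of a0 b0 a1] assms(6)[of a0 b0 b1] by auto
  qed
  moreover have "(a', b') \<in> I" if "(a, b) \<in> I" "a' \<in> A" "b' \<in> B" "leA a' a" "leB b' b" for a b a' b'
    using that assms(1,2) by (metis mem_Sigma_iff subsetD)
  moreover have "bot_AB A leA B leB \<subseteq> I"
    using assms(3,4) unfolding bot_AB_def by auto
  ultimately show ?thesis
    unfolding bi_ideal_def using assms(1) by (intro conjI allI impI) (simp | elim conjE)+
qed

lemma bi_closed: "bi I \<Longrightarrow> I \<subseteq> A \<times> B"
  unfolding bi_ideal_def by (rule conjunct1)

lemma bi_down:
  assumes "bi I" "(a, b) \<in> I" "a' \<in> A" "b' \<in> B" "leA a' a" "leB b' b"
  shows "(a', b') \<in> I"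
  using assms(1)[unfolded bi_ideal_def, THEN conjunct2, THEN conjunct1, rule_format, of a b a' b']
    assms(2-) by simp

lemma bi_bot: "bi I \<Longrightarrow> bot_AB A leA B leB \<subseteq> I"
  unfolding bi_ideal_def by (elim conjE) assumption

lemma bi_zero1: "bi I \<Longrightarrow> b \<in> B \<Longrightarrow> (A.zero, b) \<in> I"
  and bi_zero2: "bi I \<Longrightarrow> a \<in> A \<Longrightarrow> (a, B.zero) \<in> I"
  using bi_bot unfolding bot_AB_def by auto

lemma bi_join:
  assumes "bi I" "(a0, b0) \<in> I" "(a1, b1) \<in> I" "a0 = a1 \<or> b0 = b1"
  shows "(A.join a0 a1, B.join b0 b1) \<in> I"
  using assms(1)[unfolded bi_ideal_def, THEN conjunct2, THEN conjunct2, THEN conjunct2,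
      rule_format, of a0 b0 a1 b1] assms(2-) by simp

lemma bi_join1: "bi I \<Longrightarrow> (a, b) \<in> I \<Longrightarrow> (a', b) \<in> I \<Longrightarrow> (A.join a a', b) \<in> I"
  using bi_join[of I a b a' b] bi_closed[of I] by auto

lemma bi_join2: "bi I \<Longrightarrow> (a, b) \<in> I \<Longrightarrow> (a, b') \<in> I \<Longrightarrow> (a, B.join b b') \<in> I"
  using bi_join[of I a b a b'] bi_closed[of I] by auto

lemma gen_least: "bi I \<Longrightarrow> X \<subseteq> I \<Longrightarrow> gen X \<subseteq> I"
  and gen_superset: "X \<subseteq> gen X"
  unfolding bi_ideal_gen_def by auto

lemma gen_mono: "X \<subseteq> Y \<Longrightarrow> gen X \<subseteq> gen Y"
  unfolding bi_ideal_gen_def by auto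

lemma bi_gen:
  assumes "X \<subseteq> A \<times> B"
  shows "bi (gen X)"
proof (rule biI)
  have "bi (A \<times> B)" by (rule biI) auto
  then show "gen X \<subseteq> A \<times> B" using assms by (rule gen_least)
qed (unfold bi_ideal_gen_def, auto intro: bi_down bi_zero1 bi_zero2 bi_join1 bi_join2)

text \<open>The bi-ideals generated by finite subfamilies of \<open>F\<close> form a directed
  family, so their union \<open>U\<close> is again a bi-ideal. It contains
  \<open>gen (\<Union>F)\<close>, and finitely many generators then need only finitely many members
  of \<open>F\<close>.\<close>

lemma compact_gen:
  assumes "finite X" "X \<subseteq> A \<times> B"
  shows "cpt (gen X)"
  unfolding compact_bi_ideal_def
proof (intro conjI allI impI)
  show "bi (gen X)" using assms(2) by (rule bi_gen)
  fix F assume F: "\<forall>J\<in>F. bi J" and sub: "gen X \<subseteq> gen (\<Union>F)"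
  let ?fin = "\<lambda>G. G \<subseteq> F \<and> finite G"
  define U where "U = {p. \<exists>G. ?fin G \<and> p \<in> gen (\<Union>G)}"
  have bi_G: "bi (gen (\<Union>G))" if "?fin G" for G
    using F that bi_closed by (intro bi_gen) blast
  have directed: "\<exists>G. ?fin G \<and> p \<in> gen (\<Union>G) \<and> q \<in> gen (\<Union>G)" if "p \<in> U" "q \<in> U" for p q
  proof -
    obtain G H where "?fin G" "p \<in> gen (\<Union>G)" "?fin H" "q \<in> gen (\<Union>H)"
      using \<open>p \<in> U\<close> \<open>q \<in> U\<close> U_def by auto
    then show ?thesis
      using gen_mono[of "\<Union>G" "\<Union>(G \<union> H)"] gen_mono[of "\<Union>H" "\<Union>(G \<union> H)"]
      by (intro exI[of _ "G \<union> H"]) auto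
  qed
  have U_I: "p \<in> U" if "?fin G" "p \<in> gen (\<Union>G)" for p G
    using that unfolding U_def by blast
  have "bi U"
  proof (rule biI)
    show "U \<subseteq> A \<times> B"
    proof
      fix p assume "p \<in> U"
      then obtain G where G: "?fin G" "p \<in> gen (\<Union>G)" unfolding U_def by auto
      then show "p \<in> A \<times> B" using bi_closed[OF bi_G[OF G(1)]] by auto
    qed
    show "(a', b') \<in> U" if "(a, b) \<in> U" "a' \<in> A" "b' \<in> B" "leA a' a" "leB b' b" for a b a' b'
    proof -
      from that(1) obtain G where G: "?fin G" "(a, b) \<in> gen (\<Union>G)"
        unfolding U_def by blast
      show ?thesis using bi_down[OF bi_G[OF G(1)] G(2) that(2-)] G(1) by (rule U_I[rotated])
    qed
    \<comment> \<open>The empty subfamily suffices here, since every bi-ideal contains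
      \<open>bot_AB\<close>.\<close>
    show "(a, B.zero) \<in> U" if "a \<in> A" for a
      by (rule U_I[of "{}"]) (simp, rule bi_zero2[OF bi_G that], simp)
    show "(A.zero, b) \<in> U" if "b \<in> B" for b
      by (rule U_I[of "{}"]) (simp, rule bi_zero1[OF bi_G that], simp)
    show "(A.join a a', b) \<in> U" if ab: "(a, b) \<in> U" "(a', b) \<in> U" for a a' b
    proof -
      obtain G where G: "?fin G" "(a, b) \<in> gen (\<Union>G)" "(a', b) \<in> gen (\<Union>G)"
        using directed[OF ab] by auto
      show ?thesis using G(1) bi_join1[OF bi_G[OF G(1)] G(2,3)] by (rule U_I)
    qed
    show "(a, B.join b b') \<in> U" if ab: "(a, b) \<in> U" "(a, b') \<in> U" for a b b'
    proof -
      obtain G where G: "?fin G" "(a, b) \<in> gen (\<Union>G)" "(a, b') \<in> gen (\<Union>G)"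
        using directed[OF ab] by auto
      show ?thesis using G(1) bi_join2[OF bi_G[OF G(1)] G(2,3)] by (rule U_I)
    qed
  qed
  moreover have "\<Union>F \<subseteq> U"
  proof
    fix p assume "p \<in> \<Union>F"
    then obtain J where "J \<in> F" "p \<in> J" by blast
    then show "p \<in> U" using gen_superset[of "\<Union>{J}"] unfolding U_def by blast
  qed
  ultimately have "gen (\<Union>F) \<subseteq> U" by (rule gen_least)
  then have "\<forall>p\<in>X. \<exists>G. ?fin G \<and> p \<in> gen (\<Union>G)"
    using sub gen_superset[of X] unfolding U_def by blast
  then obtain g where g: "\<And>p. p \<in> X \<Longrightarrow> ?fin (g p) \<and> p \<in> gen (\<Union>(g p))"
    unfolding bchoice_iff by auto
  let ?G = "\<Union>(g ` X)"
  have fin: "?fin ?G" using g assms(1) by blast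
  have "X \<subseteq> gen (\<Union>?G)"
  proof
    fix p assume "p \<in> X"
    moreover from this have "gen (\<Union>(g p)) \<subseteq> gen (\<Union>?G)" by (intro gen_mono) blast
    ultimately show "p \<in> gen (\<Union>?G)" using g by blast
  qed
  then have "gen X \<subseteq> gen (\<Union>?G)" by (rule gen_least[OF bi_G[OF fin]])
  with fin show "\<exists>G\<subseteq>F. finite G \<and> gen X \<subseteq> gen (\<Union>G)" by (intro exI[of _ ?G]) simp
qed

text \<open>Compactness is applied to the cover of \<open>I\<close> by the bi-ideals that its single
  points generate.\<close>

lemma compact_finitely_generated:
  assumes "cpt I"
  obtains X where "finite X" "X \<subseteq> I" "I = gen X"
proof -
  have I: "bi I" and
    cI: "\<And>F. (\<forall>J\<in>F. bi J) \<Longrightarrow> I \<subseteq> gen (\<Union>F) \<Longrightarrow> \<exists>G\<subseteq>F. finite G \<and> I \<subseteq> gen (\<Union>G)"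
    using assms unfolding compact_bi_ideal_def by auto
  let ?F = "(\<lambda>p. gen {p}) ` I"
  have "\<forall>J\<in>?F. bi J" using bi_closed[OF I] by (auto intro: bi_gen)
  moreover have "I \<subseteq> gen (\<Union>?F)"
    using gen_superset[of "\<Union>?F"] gen_superset[of "{_}"] by blast
  ultimately have "\<exists>G\<subseteq>?F. finite G \<and> I \<subseteq> gen (\<Union>G)" by (rule cI)
  then obtain G where "G \<subseteq> ?F" "finite G" and G: "I \<subseteq> gen (\<Union>G)" by (elim exE conjE)
  then obtain X where X: "X \<subseteq> I" "finite X" "G = (\<lambda>p. gen {p}) ` X"
    by (meson finite_subset_image)
  have "bi (gen X)" using X(1) bi_closed[OF I] by (intro bi_gen) blast
  moreover have "\<Union>G \<subseteq> gen X" using gen_mono[of "{_}" X] X(3) by blast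
  ultimately have "I \<subseteq> gen X" using G gen_least by blast
  with X gen_least[OF I] show ?thesis by (intro that) auto
qed

text \<open>Stands for the pair (join of the first coordinates, meet of the second ones), described
  by bounds to avoid iterated operations. \<open>P\<close> is nonempty because an empty meet would
  be a top element of \<open>B\<close>.\<close>

lemma bi_bound:
  assumes I: "bi I" and "finite P" "P \<noteq> {}" "P \<subseteq> I"
  shows "\<exists>u v. (u, v) \<in> I \<and> (\<forall>p\<in>P. leA (fst p) u) \<and>
    (\<forall>w\<in>B. (\<forall>p\<in>P. leB w (snd p)) \<longrightarrow> leB w v)"
  using assms(2-)
proof (induction P rule: finite_ne_induct)
  case (singleton p)
  then have "(fst p, snd p) \<in> I" "fst p \<in> A" using bi_closed[OF I] by auto
  then show ?case using A.refl by (intro exI[of _ "fst p"] exI[of _ "snd p"]) simp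
next
  case (insert p P)
  then obtain u v where uv: "(u, v) \<in> I" "\<forall>p\<in>P. leA (fst p) u"
    "\<forall>w\<in>B. (\<forall>p\<in>P. leB w (snd p)) \<longrightarrow> leB w v" by auto
  define x y where "x = fst p" and "y = snd p"
  have xy: "(x, y) \<in> I" using insert.prems by (simp add: x_def y_def)
  have mem: "x \<in> A" "u \<in> A" "y \<in> B" "v \<in> B"
    using bi_closed[OF I] uv(1) xy by auto
  obtain z where z: "z \<in> B" "leB z y" "leB z v" "\<And>w. w \<in> B \<Longrightarrow> leB w y \<Longrightarrow> leB w v \<Longrightarrow> leB w z"
    using B.glb_exists mem(3,4) by blast
  \<comment> \<open>Both points are lowered to the meet \<open>z\<close>; sharing a second
    coordinate, they have a lateral join.\<close>
  have "(x, z) \<in> I" "(u, z) \<in> I"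
    using bi_down[OF I xy _ _ _ z(2)] bi_down[OF I uv(1) _ _ _ z(3)] mem z(1) A.refl by auto
  then have "(A.join x u, z) \<in> I" using bi_join1 I by blast
  moreover have "leA (fst q) (A.join x u)" if "q \<in> insert p P" for q
  proof (cases "q = p")
    case True
    then show ?thesis using mem A.join_ub1 by (simp add: x_def)
  next
    case False
    with that have "q \<in> P" by simp
    then have "leA (fst q) u" "fst q \<in> A" using uv(2) insert.prems bi_closed[OF I] by auto
    then show ?thesis using mem A.join_ub2 A.trans[of "fst q" u "A.join x u"] by simp
  qed
  moreover have "leB w z" if "w \<in> B" "\<forall>q\<in>insert p P. leB w (snd q)" for w
    using that uv(3) by (intro z(4)) (auto simp: y_def)
  ultimately show ?case by blast
qed

end

section \<open>The extension of a lattice by pairs \<open>(y, X)\<close>\<close>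

locale lattice_extension = zero_lattice B leB
  for B :: "'b set" and leB :: "'b \<Rightarrow> 'b \<Rightarrow> bool" +
  fixes code :: "'b \<Rightarrow> 'b set \<Rightarrow> 'c"
  assumes code_inject [simp]: "code y X = code y' X' \<longleftrightarrow> y = y' \<and> X = X'"
begin

definition down :: "'b \<Rightarrow> 'b set" where
  "down y = {t \<in> B. leB t y}"

text \<open>The pairs pass through an injective \<open>code\<close> into a free type, so that they
  can later be placed in the one carrier type over which the hypothesis ranges.\<close>

definition ext :: "'c set" where
  "ext = {code y X |y X. y \<in> B \<and> down y \<subseteq> X \<and> X \<subseteq> B}"

definition ext_le :: "'c \<Rightarrow> 'c \<Rightarrow> bool" where
  "ext_le Z Z' \<longleftrightarrow> (\<exists>y X y' X'. Z = code y X \<and> Z' = code y' X' \<and> leB y y' \<and> X \<subseteq> X')"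

lemma ext_le_code [simp]: "ext_le (code y X) (code y' X') \<longleftrightarrow> leB y y' \<and> X \<subseteq> X'"
  unfolding ext_le_def by simp

lemma code_in_ext [simp]: "code y X \<in> ext \<longleftrightarrow> y \<in> B \<and> down y \<subseteq> X \<and> X \<subseteq> B"
  unfolding ext_def by auto

lemma extE:
  assumes "Z \<in> ext"
  obtains y X where "Z = code y X" "y \<in> B" "down y \<subseteq> X" "X \<subseteq> B"
  using assms unfolding ext_def by auto

lemma in_down: "t \<in> down y \<longleftrightarrow> t \<in> B \<and> leB t y"
  unfolding down_def by simp

lemma down_subset [simp]: "down y \<subseteq> B"
  unfolding down_def by auto

lemma down_self: "y \<in> B \<Longrightarrow> y \<in> down y"
  by (simp add: in_down refl)

lemma down_mono: "y \<in> B \<Longrightarrow> z \<in> B \<Longrightarrow> leB y z \<Longrightarrow> down y \<subseteq> down z"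
  unfolding down_def using trans by blast

lemma down_zero: "down zero = {zero}"
  unfolding down_def using refl le_zero by auto

text \<open>\<open>X \<union> Y\<close> may miss elements of \<open>down (join y z)\<close>, so that
  set is added. For \<open>y = z = zero\<close> it is just \<open>{zero}\<close>, which
  \<open>X\<close> contains already: there joins are plain unions, the source of
  distributivity.\<close>

lemma ext_lub:
  assumes "code y X \<in> ext" "code z Y \<in> ext"
  shows "is_lub_on ext ext_le (code y X) (code z Y) (code (join y z) (X \<union> Y \<union> down (join y z)))"
  using assms unfolding is_lub_on_def
  by (auto elim!: extE simp: join_ub1 join_ub2 join_least)
    (meson down_mono join_closed join_least subsetD)

lemma ext_least: "is_least_on ext ext_le (code zero {zero})"
  unfolding is_least_on_def
  by (auto elim!: extE simp: down_zero zero_le) (meson in_down subsetD zero_closed zero_le)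

lemma ext_lattice: "zero_lattice ext ext_le"
proof
  have "partial_order_on' ext ext_le"
    unfolding partial_order_on'_def
    by (auto elim!: extE simp: refl antisym) (meson trans, blast)
  moreover have "\<exists>Z. is_glb_on ext ext_le Z1 Z2 Z" if "Z1 \<in> ext" "Z2 \<in> ext" for Z1 Z2
  proof -
    from that(1) obtain y X where 1: "Z1 = code y X" "y \<in> B" "down y \<subseteq> X" "X \<subseteq> B"
      by (rule extE)
    from that(2) obtain z Y where 2: "Z2 = code z Y" "z \<in> B" "down z \<subseteq> Y" "Y \<subseteq> B"
      by (rule extE)
    obtain m where m: "m \<in> B" "leB m y" "leB m z" "\<And>w. w \<in> B \<Longrightarrow> leB w y \<Longrightarrow> leB w z \<Longrightarrow> leB w m"
      using glb_exists 1(2) 2(2) by blast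
    \<comment> \<open>Unlike joins, meets need no correction: the intersection already contains
      \<open>down m\<close>.\<close>
    have "down m \<subseteq> X \<inter> Y" 
      using down_mono[OF m(1) 1(2) m(2)] down_mono[OF m(1) 2(2) m(3)] 1(3) 2(3) by blast
    then have "is_glb_on ext ext_le Z1 Z2 (code m (X \<inter> Y))"
      unfolding is_glb_on_def using 1 2 m by (auto elim!: extE)
    then show ?thesis ..
  qed
  moreover have "\<exists>Z. is_lub_on ext ext_le Z1 Z2 Z" if "Z1 \<in> ext" "Z2 \<in> ext" for Z1 Z2
    using that by (elim extE) (auto intro!: exI ext_lub)
  ultimately show "lattice_zero_on ext ext_le"
    unfolding lattice_zero_on_def using ext_least by blast
qed

lemma ext_zero: "zero_on ext ext_le = code zero {zero}"
  using zero_lattice.zero_eqI[OF ext_lattice ext_least] .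

lemma ext_join:
  "code y X \<in> ext \<Longrightarrow> code z Y \<in> ext \<Longrightarrow>
    join_on ext ext_le (code y X) (code z Y) = code (join y z) (X \<union> Y \<union> down (join y z))"
  using zero_lattice.join_eqI[OF ext_lattice _ _ ext_lub] .

end

section \<open>Transfer to the extension, and finite cappings\<close>

locale tensor_extension = lattice_pair A leA B leB + B: lattice_extension B leB code
  for A :: "'a set" and leA and B :: "'b set" and leB and code :: "'b \<Rightarrow> 'b set \<Rightarrow> 'c"
begin

sublocale E: lattice_pair A leA B.ext B.ext_le
  by (rule lattice_pair.intro[OF A.zero_lattice_axioms B.ext_lattice])

text \<open>A shape for the bi-ideals that will bound \<open>I'\<close>, \<open>J\<close> and
  \<open>K\<close> from above. Points over \<open>A.zero\<close> belong to it outright, so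
  \<open>R\<close> matters only at the other points.\<close>

definition rel_set :: "('a \<Rightarrow> 'b \<Rightarrow> 'b set \<Rightarrow> bool) \<Rightarrow> ('a \<times> 'c) set" where
  "rel_set R = {(x, code y X) |x y X. x \<in> A \<and> code y X \<in> B.ext \<and> (x = A.zero \<or> R x y X)}"

lemma mem_rel_set [simp]:
  "(x, code y X) \<in> rel_set R \<longleftrightarrow> x \<in> A \<and> code y X \<in> B.ext \<and> (x = A.zero \<or> R x y X)"
  unfolding rel_set_def by auto

lemma bi_rel_set:
  assumes zero: "\<And>x. x \<in> A \<Longrightarrow> R x B.zero {B.zero}"
    and down: "\<And>x y X x' y' X'. R x y X \<Longrightarrow> x \<in> A \<Longrightarrow> code y X \<in> B.ext \<Longrightarrow> x' \<in> A
      \<Longrightarrow> code y' X' \<in> B.ext \<Longrightarrow> leA x' x \<Longrightarrow> leB y' y \<Longrightarrow> X' \<subseteq> X \<Longrightarrow> R x' y' X'"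
    and join1: "\<And>x x' y X. R x y X \<Longrightarrow> R x' y X \<Longrightarrow> x \<in> A \<Longrightarrow> x' \<in> A \<Longrightarrow> code y X \<in> B.ext
      \<Longrightarrow> R (A.join x x') y X"
    and join2: "\<And>x y X z Y. R x y X \<Longrightarrow> R x z Y \<Longrightarrow> x \<in> A \<Longrightarrow> code y X \<in> B.ext
      \<Longrightarrow> code z Y \<in> B.ext \<Longrightarrow> R x (B.join y z) (X \<union> Y \<union> B.down (B.join y z))"
  shows "E.bi (rel_set R)"
proof (rule E.biI)
  show "rel_set R \<subseteq> A \<times> B.ext" unfolding rel_set_def by auto
  show "(x', Z') \<in> rel_set R"
    if "(x, Z) \<in> rel_set R" "x' \<in> A" "Z' \<in> B.ext" "leA x' x" "B.ext_le Z' Z" for x Z x' Z'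
    using that down A.le_zero unfolding rel_set_def
    by (auto elim!: B.extE)
  show "(x, zero_on B.ext B.ext_le) \<in> rel_set R" if "x \<in> A" for x
    using that zero by (simp add: B.ext_zero B.down_zero)
  show "(A.zero, Z) \<in> rel_set R" if "Z \<in> B.ext" for Z
    using that by (auto elim: B.extE)
  show "(A.join x x', Z) \<in> rel_set R" if "(x, Z) \<in> rel_set R" "(x', Z) \<in> rel_set R" for x x' Z
    using that join1 unfolding rel_set_def by auto
  show "(x, join_on B.ext B.ext_le Z Z') \<in> rel_set R"
    if "(x, Z) \<in> rel_set R" "(x, Z') \<in> rel_set R" for x Z Z'
    using that join2 unfolding rel_set_def by (auto simp: B.ext_join)
qed

text \<open>The map \<open>y \<mapsto> code y (down y)\<close> preserves order, zero and joins, so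
  the preimage of \<open>I'\<close> is a bi-ideal of \<open>A \<times> B\<close>; it contains
  \<open>P\<close>.\<close>

lemma embed_gen:
  assumes I': "E.bi I'" and P: "P \<subseteq> A \<times> B" "\<And>a b. (a, b) \<in> P \<Longrightarrow> (a, code b (B.down b)) \<in> I'"
    and xy: "(x, y) \<in> gen P"
  shows "(x, code y (B.down y)) \<in> I'"
proof -
  let ?I = "{(x, y). x \<in> A \<and> y \<in> B \<and> (x, code y (B.down y)) \<in> I'}"
  have "bi ?I"
  proof (rule biI)
    show "(a', b') \<in> ?I" if "(a, b) \<in> ?I" "a' \<in> A" "b' \<in> B" "leA a' a" "leB b' b" for a b a' b'
      using that E.bi_down[OF I', of a "code b (B.down b)" a' "code b' (B.down b')"]
        B.down_mono[of b' b] by simp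
    show "(a, B.zero) \<in> ?I" if "a \<in> A" for a
      using that E.bi_zero2[OF I'] by (simp add: B.ext_zero B.down_zero)
    show "(A.zero, b) \<in> ?I" if "b \<in> B" for b
      using that E.bi_zero1[OF I'] by simp
    show "(A.join a a', b) \<in> ?I" if "(a, b) \<in> ?I" "(a', b) \<in> ?I" for a a' b
      using that E.bi_join1[OF I', of a "code b (B.down b)" a'] by simp
    show "(a, B.join b b') \<in> ?I" if "(a, b) \<in> ?I" "(a, b') \<in> ?I" for a b b'
    proof -
      have b: "b \<in> B" "b' \<in> B" using that by auto
      then have "B.down b \<union> B.down b' \<union> B.down (B.join b b') = B.down (B.join b b')"
        using B.down_mono[of b "B.join b b'"] B.down_mono[of b' "B.join b b'"]
        by (simp add: B.join_ub1 B.join_ub2 Un_absorb1)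
      then show ?thesis using that b E.bi_join2[OF I', of a "code b (B.down b)" "code b' (B.down b')"]
        by (simp add: B.ext_join)
    qed
  qed auto
  moreover have "P \<subseteq> ?I" using P by auto
  ultimately have "gen P \<subseteq> ?I" by (rule gen_least)
  then show ?thesis using xy by blast
qed

lemma cappedI:
  assumes I: "bi I" and fin: "finite \<Gamma>" and sub: "\<Gamma> \<subseteq> I"
    and cover: "\<And>x y. (x, y) \<in> I \<Longrightarrow> x \<noteq> A.zero \<Longrightarrow> y \<noteq> B.zero
      \<Longrightarrow> \<exists>(c, d)\<in>\<Gamma>. leA x c \<and> leB y d"
  shows "capped A leA B leB I"
  unfolding capped_def
proof (intro exI[of _ \<Gamma>] conjI equalityI subsetI)
  show "finite \<Gamma>" "\<And>p. p \<in> \<Gamma> \<Longrightarrow> p \<in> A \<times> B" using fin sub bi_closed[OF I] by auto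
  have bot: "bot_AB A leA B leB \<subseteq> I" using I by (rule bi_bot)
  fix p :: "'a \<times> 'b"
  obtain x y where p: "p = (x, y)" by (cases p)
  show "p \<in> I" if "p \<in> {(a, b). a \<in> A \<and> b \<in> B \<and>
      (\<exists>(c, d)\<in>\<Gamma> \<union> bot_AB A leA B leB. leA a c \<and> leB b d)}"
    using that sub bot bi_down[OF I] by blast
  show "p \<in> {(a, b). a \<in> A \<and> b \<in> B \<and>
      (\<exists>(c, d)\<in>\<Gamma> \<union> bot_AB A leA B leB. leA a c \<and> leB b d)}" if "p \<in> I"
  proof -
    have xy: "x \<in> A" "y \<in> B" "(x, y) \<in> I" using that p bi_closed[OF I] by auto
    show ?thesis
    proof (cases "x = A.zero \<or> y = B.zero")
      case True
      then have "(x, y) \<in> bot_AB A leA B leB" using xy unfolding bot_AB_def by blast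
      then show ?thesis using p xy A.refl B.refl by blast
    next
      case False
      then show ?thesis using p xy cover by blast
    qed
  qed
qed

theorem compact_capped:
  assumes lat: "tensor_is_lattice A leA B.ext B.ext_le" and "cpt I"
  shows "capped A leA B leB I"
proof -
  obtain P where P: "finite P" "P \<subseteq> I" "I = gen P"
    using \<open>cpt I\<close> by (rule compact_finitely_generated)
  have I: "bi I" using \<open>cpt I\<close> unfolding compact_bi_ideal_def by blast
  have PAB: "P \<subseteq> A \<times> B" using P(2) bi_closed[OF I] by blast
  obtain c where c: "c \<in> A" "\<And>a b. (a, b) \<in> P \<Longrightarrow> leA a c"
    using A.finite_upper_bound[of "fst ` P"] P(1) PAB by force
  have "bi {(x, y). x \<in> A \<and> y \<in> B \<and> (leA x c \<or> y = B.zero)}"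
    by (rule biI) (use c(1) in \<open>auto intro: A.trans B.le_zero A.zero_le A.join_least\<close>)
  from gen_least[OF this, of P]
  have I_below: "leA x c" if "(x, y) \<in> I" "y \<noteq> B.zero" for x y
    using that P(3) PAB c(2) by blast

  define P' where "P' = (\<lambda>(a, b). (a, code b (B.down b))) ` P"
  define I' where "I' = E.gen P'"
  define d where "d = code B.zero B"
  define J where "J = E.gen {(c, d)}"
  have P': "finite P'" "P' \<subseteq> A \<times> B.ext"
    using P(1) PAB unfolding P'_def by auto
  have d: "d \<in> B.ext" unfolding d_def by simp
  have cpt': "E.cpt I'" "E.cpt J"
    unfolding I'_def J_def by (rule E.compact_gen; use P' d c(1) in simp)+
  have I': "E.bi I'" and J: "E.bi J"
    unfolding I'_def J_def by (rule E.bi_gen; use P' d c(1) in simp)+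
  \<comment> \<open>So far \<open>K\<close> is only the greatest compact bi-ideal inside
    \<open>I'\<close> and \<open>J\<close>, not yet their intersection.\<close>
  obtain K where K: "E.cpt K" "K \<subseteq> I'" "K \<subseteq> J"
    and K_max: "\<And>K'. E.cpt K' \<Longrightarrow> K' \<subseteq> I' \<Longrightarrow> K' \<subseteq> J \<Longrightarrow> K' \<subseteq> K"
    using lat[unfolded tensor_is_lattice_def, THEN spec, THEN spec, THEN mp, OF conjI, OF cpt',
        THEN conjunct1] by auto
  obtain F where F: "finite F" "F \<subseteq> K" "K = E.gen F"
    using K(1) by (rule E.compact_finitely_generated)

  \<comment> \<open>This bound on \<open>I'\<close> supplies, for a point with set \<open>X\<close>
    and nonzero \<open>x\<close>, an element \<open>y'\<close> above all of \<open>X\<close> with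
    \<open>(x, y')\<close> still in \<open>I\<close>.\<close>
  let ?RI = "\<lambda>x y X. \<exists>y'. (x, y') \<in> I \<and> X \<subseteq> B.down y'"
  have "E.bi (rel_set ?RI)"
  proof (rule bi_rel_set)
    fix x x' y X assume "?RI x y X" "?RI x' y X"
    then obtain u v where u: "(x, u) \<in> I" "X \<subseteq> B.down u" and v: "(x', v) \<in> I" "X \<subseteq> B.down v"
      by blast
    have uv: "u \<in> B" "v \<in> B" "x \<in> A" "x' \<in> A" using u(1) v(1) bi_closed[OF I] by auto
    \<comment> \<open>Meets in \<open>B\<close> enter here: at \<open>w\<close> the two points of
      \<open>I\<close> share a second coordinate.\<close>
    then obtain w where w: "w \<in> B" "leB w u" "leB w v"
      "\<And>t. t \<in> B \<Longrightarrow> leB t u \<Longrightarrow> leB t v \<Longrightarrow> leB t w"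
      using B.glb_exists by metis
    have "(x, w) \<in> I" "(x', w) \<in> I"
      using bi_down[OF I u(1) uv(3) w(1) _ w(2)] bi_down[OF I v(1) uv(4) w(1) _ w(3)] uv A.refl
      by auto
    moreover have "X \<subseteq> B.down w" using u(2) v(2) w(4) unfolding B.down_def by blast
    ultimately show "?RI (A.join x x') y X" using bi_join1[OF I] by blast
  next
    fix x y X z Y assume "?RI x y X" "?RI x z Y" and mem: "code y X \<in> B.ext" "code z Y \<in> B.ext"
    then obtain u v where u: "(x, u) \<in> I" "X \<subseteq> B.down u" and v: "(x, v) \<in> I" "Y \<subseteq> B.down v"
      by blast
    have uv: "u \<in> B" "v \<in> B" using u(1) v(1) bi_closed[OF I] by auto
    \<comment> \<open>\<open>y\<close> lies in \<open>down y\<close>, hence in \<open>X\<close>,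
      hence below \<open>u\<close>; likewise \<open>z\<close> below \<open>v\<close>.\<close>
    have "y \<in> B" "z \<in> B" "y \<in> B.down u" "z \<in> B.down v"
      using mem u(2) v(2) B.down_self[of y] B.down_self[of z] by auto
    then have yz: "y \<in> B" "z \<in> B" "leB y u" "leB z v" by (simp_all add: B.in_down)
    have "B.down u \<subseteq> B.down (B.join u v)" "B.down v \<subseteq> B.down (B.join u v)"
      using uv by (simp_all add: B.down_mono B.join_ub1 B.join_ub2)
    moreover have "leB y (B.join u v)" "leB z (B.join u v)"
      using B.trans[of y u "B.join u v"] B.trans[of z v "B.join u v"] uv yz
      by (simp_all add: B.join_ub1 B.join_ub2)
    then have "leB (B.join y z) (B.join u v)"
      using uv yz by (simp add: B.join_least)
    then have "B.down (B.join y z) \<subseteq> B.down (B.join u v)"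
      using uv yz by (simp add: B.down_mono)
    ultimately have "X \<union> Y \<union> B.down (B.join y z) \<subseteq> B.down (B.join u v)"
      using u(2) v(2) by blast
    with bi_join2[OF I u(1) v(1)] show "?RI x (B.join y z) (X \<union> Y \<union> B.down (B.join y z))"
      by blast
  next
    fix x y X x' y' X'
    assume "?RI x y X" and x': "x' \<in> A" "leA x' x" and "X' \<subseteq> X"
    then obtain u where u: "(x, u) \<in> I" "X' \<subseteq> B.down u" by blast
    then have "u \<in> B" using bi_closed[OF I] by auto
    then have "(x', u) \<in> I" using bi_down[OF I u(1) x'(1) _ x'(2)] B.refl by simp
    with u(2) show "?RI x' y' X'" by blast
  next
    fix x assume "x \<in> A"
    then have "(x, B.zero) \<in> I" by (rule bi_zero2[OF I])
    then show "?RI x B.zero {B.zero}" using B.down_zero by blast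
  qed
  moreover have "P' \<subseteq> rel_set ?RI"
  proof -
    have "(a, code b (B.down b)) \<in> rel_set ?RI" if "(a, b) \<in> P" for a b
    proof -
      have "a \<in> A" "b \<in> B" "(a, b) \<in> I" using that P(2) PAB by auto
      then show ?thesis by auto
    qed
    then show ?thesis unfolding P'_def by auto
  qed
  ultimately have I'_sub: "I' \<subseteq> rel_set ?RI" unfolding I'_def by (rule E.gen_least)

  let ?RJ = "\<lambda>(x :: 'a) y (X :: 'b set). y = B.zero"
  have "E.bi (rel_set ?RJ)"
    by (rule bi_rel_set) (auto intro: B.le_zero)
  then have J_sub: "J \<subseteq> rel_set ?RJ"
    unfolding J_def using d c(1) by (intro E.gen_least) (auto simp: d_def)

  have in_K: "(x, code B.zero (B.down y)) \<in> K" if xy: "(x, y) \<in> I" and "y \<noteq> B.zero" for x y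
  proof -
    have mem: "x \<in> A" "y \<in> B" using xy bi_closed[OF I] by auto
    then have e: "code B.zero (B.down y) \<in> B.ext"
      by (simp add: B.down_mono B.zero_le)
    have "(a, code b (B.down b)) \<in> I'" if "(a, b) \<in> P" for a b
      using that E.gen_superset[of P'] unfolding I'_def P'_def by auto
    from embed_gen[OF I' PAB this] have "(x, code y (B.down y)) \<in> I'"
      using xy P(3) by simp
    then have inI': "(x, code B.zero (B.down y)) \<in> I'"
      by (rule E.bi_down[OF I']) (use mem e in \<open>simp_all add: A.refl B.zero_le\<close>)
    have "(c, d) \<in> J" unfolding J_def using E.gen_superset[of "{(c, d)}"] by simp
    then have inJ: "(x, code B.zero (B.down y)) \<in> J"
      by (rule E.bi_down[OF J]) (use mem e that I_below in \<open>simp_all add: d_def B.refl\<close>)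
    \<comment> \<open>A single point generates a compact bi-ideal, so the maximality of
      \<open>K\<close> reaches each such common point of \<open>I'\<close> and
      \<open>J\<close>.\<close>
    let ?G = "E.gen {(x, code B.zero (B.down y))}"
    have "E.cpt ?G" by (rule E.compact_gen) (use mem e in simp_all)
    moreover have "?G \<subseteq> I'" "?G \<subseteq> J"
      using E.gen_least[OF I', of "{_}"] E.gen_least[OF J, of "{_}"] inI' inJ by simp_all
    ultimately have "?G \<subseteq> K" by (rule K_max)
    then show ?thesis using E.gen_superset[of "{(x, code B.zero (B.down y))}"] by auto
  qed

  text \<open>The condition expresses \<open>x \<le> (join of x\<^sub>j with t \<in> X\<^sub>j)\<close> without naming the join.\<close>
  let ?ub = "\<lambda>t u. \<forall>x y X. (x, code y X) \<in> F \<longrightarrow> x \<noteq> A.zero \<longrightarrow> t \<in> X \<longrightarrow> leA x u"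
  let ?RK = "\<lambda>x y X. y = B.zero \<and> (\<forall>t\<in>X. t \<noteq> B.zero \<longrightarrow> (\<forall>u\<in>A. ?ub t u \<longrightarrow> leA x u))"
  have "E.bi (rel_set ?RK)"
  proof (rule bi_rel_set)
    fix x y X x' y' X'
    assume R: "?RK x y X" and *: "x \<in> A" "code y' X' \<in> B.ext" "x' \<in> A" "leA x' x" "leB y' y"
      "X' \<subseteq> X"
    have "leA x' u" if "t \<in> X'" "t \<noteq> B.zero" "u \<in> A" "?ub t u" for t u
    proof -
      have "leA x u" using R that \<open>X' \<subseteq> X\<close> by blast
      then show ?thesis using A.trans[of x' x u] * that(3) by simp
    qed
    moreover have "y' = B.zero" using R * by (simp add: B.le_zero)
    ultimately show "?RK x' y' X'" by blast
  next
    fix x x' y X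
    assume "?RK x y X" "?RK x' y X" "x \<in> A" "x' \<in> A"
    then show "?RK (A.join x x') y X" using A.join_least by blast
  next
    \<comment> \<open>Distributivity is used here: with \<open>y = z = B.zero\<close> the joined set
      is \<open>X \<union> Y \<union> {B.zero}\<close>, so a nonzero \<open>t\<close> comes from
      \<open>X\<close> or from \<open>Y\<close>. The element \<open>B.zero\<close> lies in every set
      and has to be exempt.\<close>
    fix x y X z Y
    assume "?RK x y X" "?RK x z Y"
    then show "?RK x (B.join y z) (X \<union> Y \<union> B.down (B.join y z))"
      by (auto simp: B.down_zero)
  qed simp
  moreover have "F \<subseteq> rel_set ?RK"
  proof
    fix p assume "p \<in> F"
    then have "p \<in> rel_set ?RJ" using F(2) K(3) J_sub by blast
    then obtain x y X where p: "p = (x, code y X)" "x \<in> A" "code y X \<in> B.ext"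
      "x = A.zero \<or> y = B.zero" unfolding rel_set_def by blast
    \<comment> \<open>A generator with \<open>t\<close> in its set is itself among the elements that
      \<open>u\<close> bounds.\<close>
    have "?RK x y X" if "x \<noteq> A.zero" using that p(4) \<open>p \<in> F\<close> unfolding p(1) by blast
    then have "(x, code y X) \<in> rel_set ?RK" using p(2,3) unfolding mem_rel_set by blast
    then show "p \<in> rel_set ?RK" unfolding p(1) .
  qed
  ultimately have K_sub: "K \<subseteq> rel_set ?RK" unfolding F(3) by (rule E.gen_least)

  \<comment> \<open>Generators over \<open>A.zero\<close> are dropped, since
    \<open>rel_set ?RI\<close> says nothing about their sets. For the others, \<open>h\<close> picks
    the \<open>y'\<close> of \<open>?RI\<close>.\<close>
  define Fp where "Fp = {p \<in> F. fst p \<noteq> A.zero}"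
  have "\<exists>h. (fst p, h) \<in> I \<and> (\<forall>y X. snd p = code y X \<longrightarrow> X \<subseteq> B.down h)" if "p \<in> Fp" for p
  proof -
    have "p \<in> rel_set ?RI" "fst p \<noteq> A.zero"
      using that F(2) K(2) I'_sub unfolding Fp_def by blast+
    then obtain x y X y' where "p = (x, code y X)" "(x, y') \<in> I" "X \<subseteq> B.down y'"
      unfolding rel_set_def by auto
    then show ?thesis by (intro exI[of _ y']) simp
  qed
  then obtain h where h: "\<And>p. p \<in> Fp \<Longrightarrow> (fst p, h p) \<in> I"
    "\<And>p y X. p \<in> Fp \<Longrightarrow> snd p = code y X \<Longrightarrow> X \<subseteq> B.down (h p)" by metis
  define Q where "Q = (\<lambda>p. (fst p, h p)) ` Fp"
  have Q: "finite Q" "Q \<subseteq> I" using F(1) h(1) unfolding Q_def Fp_def by auto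
  \<comment> \<open>The bounds of \<open>bi_bound\<close>: \<open>(u, v)\<close> replaces the join
    and meet over \<open>T\<close>. The capping takes one such pair for each nonempty subset of
    \<open>Q\<close>.\<close>
  define good where "good = (\<lambda>T (u, v). (u, v) \<in> I \<and> (\<forall>p\<in>T. leA (fst p) u) \<and>
    (\<forall>w\<in>B. (\<forall>p\<in>T. leB w (snd p)) \<longrightarrow> leB w v))"
  have "\<exists>p. good T p" if "T \<subseteq> Q" "T \<noteq> {}" for T
  proof -
    have "finite T" "T \<subseteq> I" using that Q finite_subset by auto
    then show ?thesis using bi_bound[OF I _ that(2)] unfolding good_def by auto
  qed
  then obtain g where g: "\<And>T. T \<subseteq> Q \<Longrightarrow> T \<noteq> {} \<Longrightarrow> good T (g T)" by metis
  show ?thesis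
  proof (rule cappedI[OF I])
    show "finite (g ` (Pow Q - {{}}))" using Q(1) by blast
    show "g ` (Pow Q - {{}}) \<subseteq> I"
    proof
      fix p assume "p \<in> g ` (Pow Q - {{}})"
      then obtain T where "T \<subseteq> Q" "T \<noteq> {}" "p = g T" by blast
      then have "good T p" using g by simp
      then show "p \<in> I" unfolding good_def by (cases p) simp
    qed
    fix x y assume xy: "(x, y) \<in> I" "x \<noteq> A.zero" "y \<noteq> B.zero"
    then have mem: "x \<in> A" "y \<in> B" using bi_closed[OF I] by auto
    have "?RK x B.zero (B.down y)" using in_K[OF xy(1,3)] K_sub xy(2) by auto
    \<comment> \<open>The condition \<open>?RK\<close> is read at \<open>t = y\<close>, which
      belongs to \<open>down y\<close>.\<close>
    then have least: "leA x u" if "u \<in> A" "?ub y u" for u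
      using that mem xy(3) B.down_self by blast
    \<comment> \<open>The pairs \<open>(fst p, h p)\<close> from those generators whose set contains
      \<open>y\<close>. If there were none, \<open>A.zero\<close> would be an admissible bound
      \<open>u\<close> and \<open>x\<close> would be zero.\<close>
    define T where "T = (\<lambda>p. (fst p, h p)) ` {p \<in> Fp. \<exists>z X. snd p = code z X \<and> y \<in> X}"
    have T_mem: "\<exists>k. (x', k) \<in> T" if "(x', code z X) \<in> F" "x' \<noteq> A.zero" "y \<in> X" for x' z X
      using that unfolding T_def Fp_def by force
    have "T \<noteq> {}"
    proof
      assume "T = {}"
      then have "?ub y A.zero" using T_mem by blast
      then show False using least[of A.zero] A.le_zero mem xy(2) by simp
    qed
    moreover have TQ: "T \<subseteq> Q" unfolding T_def Q_def by auto
    moreover obtain u v where uv: "g T = (u, v)" by (cases "g T")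
    ultimately have good: "(u, v) \<in> I" "\<forall>p\<in>T. leA (fst p) u"
      "\<forall>w\<in>B. (\<forall>p\<in>T. leB w (snd p)) \<longrightarrow> leB w v" using g[of T] unfolding good_def by auto
    have "u \<in> A" using good(1) bi_closed[OF I] by blast
    moreover have "?ub y u" using good(2) T_mem by fastforce
    ultimately have "leA x u" by (rule least)
    \<comment> \<open>For each such generator, \<open>y\<close> lies in its set and thus in
      \<open>down (h p)\<close>; so \<open>y\<close> is a lower bound of the second coordinates of
      \<open>T\<close>.\<close>
    moreover have "leB y v"
      using good(3) mem h(2) unfolding T_def B.down_def by fastforce
    moreover have "(u, v) \<in> g ` (Pow Q - {{}})"
      unfolding uv[symmetric] using TQ \<open>T \<noteq> {}\<close> by simp
    ultimately show "\<exists>(c, d)\<in>g ` (Pow Q - {{}}). leA x c \<and> leB y d" by blast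
  qed
qed

end

section \<open>Coding the pairs inside the carrier type of the hypothesis\<close>

lemma ex_inj_double:
  includes cardinal_syntax
  shows "\<exists>g :: 'b + 'b \<Rightarrow> 'b + nat. inj g"
proof (cases "finite (UNIV :: 'b set)")
  case True
  then obtain h :: "'b \<Rightarrow> nat" where "inj h" using finite_imp_inj_to_nat_seg by blast
  \<comment> \<open>The first copy of \<open>'b\<close> stays in place and the second one goes into
    \<open>nat\<close>.\<close>
  then have "inj (map_sum (id :: 'b \<Rightarrow> 'b) h)" by (simp add: sum.inj_map)
  then show ?thesis by blast
next
  case False
  \<comment> \<open>Two copies of an infinite type are equinumerous with one, so both fit into the
    left summand.\<close>
  then have "|(UNIV :: 'b set) <+> (UNIV :: 'b set)| =o |UNIV :: 'b set|"
    by (rule card_of_Plus_infinite1) (rule ordIso_imp_ordLeq[OF card_of_refl])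
  from card_of_ordLeq[THEN iffD2, OF ordIso_imp_ordLeq[OF this]]
  obtain f :: "'b + 'b \<Rightarrow> 'b" where "inj f" by auto
  then have "inj (Inl \<circ> f :: 'b + 'b \<Rightarrow> 'b + nat)" by (simp add: inj_compose)
  then show ?thesis by blast
qed

text \<open>The carrier of the hypothesis offers one copy of \<open>'b\<close> only; the \<open>nat\<close> summand supplies the
  missing room when \<open>'b\<close> is finite.\<close>
definition pair_code :: "('b + 'b \<Rightarrow> 'b + nat) \<Rightarrow> 'b \<Rightarrow> 'b set \<Rightarrow> ('a + 'b + nat) set" where
  "pair_code g y X = Inr ` g ` ({y} <+> X)"

text \<open>The tagged sum \<open>{y} <+> X\<close> determines both parts as preimages under
  \<open>Inl\<close> and \<open>Inr\<close>, and images under the injections \<open>g\<close> and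
  \<open>Inr\<close> preserve this.\<close>

lemma pair_code_inject:
  fixes g :: "'b + 'b \<Rightarrow> 'b + nat"
  assumes "inj g"
  shows "pair_code g y X = pair_code g y' X' \<longleftrightarrow> y = y' \<and> X = X'"
proof -
  have "Inl -` ({y} <+> X) = {y}" "Inr -` ({y} <+> X) = X" for y :: 'b and X :: "'b set"
    by auto
  then have "{y} <+> X = {y'} <+> X' \<longleftrightarrow> y = y' \<and> X = X'"
    by (metis singleton_inject)
  then show ?thesis
    unfolding pair_code_def inj_image_eq_iff[OF inj_Inr] inj_image_eq_iff[OF assms] .
qed

theorem theorem3p3:
  fixes A :: "'a set" and leA :: "'a \<Rightarrow> 'a \<Rightarrow> bool"
  assumes "lattice_zero_on A leA"
    and "\<forall>(L :: ('a + 'b + nat) set set) leL. lattice_zero_on L leL \<longrightarrow> tensor_is_lattice A leA L leL"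
  shows "\<forall>(L :: 'b set) leL. lattice_zero_on L leL \<longrightarrow> capped_tensor A leA L leL"
proof (intro allI impI)
  fix L :: "'b set" and leL
  assume "lattice_zero_on L leL"
  moreover obtain g :: "'b + 'b \<Rightarrow> 'b + nat" where "inj g" using ex_inj_double by blast
  \<comment> \<open>With this code \<open>B.ext\<close> is a set of elements of type
    \<open>('a + 'b + nat) set\<close>, so the hypothesis applies to it.\<close>
  ultimately interpret
    tensor_extension A leA L leL "pair_code g :: _ \<Rightarrow> _ \<Rightarrow> ('a + 'b + nat) set"
    using assms(1) by unfold_locales (auto simp: pair_code_inject)
  have "tensor_is_lattice A leA B.ext B.ext_le"
    using assms(2) E.B.lattice_zero by simp
  then show "capped_tensor A leA L leL"
    unfolding capped_tensor_def using compact_capped by simp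
qed

end
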